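(* Let $\lambda$ be a positive real number and let $n$ be a positive integer. Then \[ \sum_{k=0}^{\infty}\lambda^{-2k}\binom{n}{k}_{\lambda}^{2}=\frac{2\lambda}{n}\,\frac{\Gamma\big(\frac{2n}{\lambda}\big)}{\Gamma\big(\frac{n}{\lambda}\big)^{2}}. \]
   Context: $(x)_{0,\lambda}=1$, $(x)_{k,\lambda}=x(x-\lambda)\cdots(x-(k-1)\lambda)$ for $k\ge1$, and $\binom{x}{k}_{\lambda}=(x)_{k,\lambda}/k!$. $\Gamma$ denotes the Euler gamma function. *)

theory Defs
  imports "HOL-Analysis.Gamma_Function"
begin

definition degenerate_falling_factorial :: "real \<Rightarrow> real \<Rightarrow> nat \<Rightarrow> real" where
  "degenerate_falling_factorial l x k = (\<Prod>i<k. x - real i * l)"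

definition degenerate_binomial :: "real \<Rightarrow> real \<Rightarrow> nat \<Rightarrow> real" where
  "degenerate_binomial l x k = degenerate_falling_factorial l x k / fact k"

end

theory Submission
  imports Defs
begin

text \<open>
  With \<open>a = n / \<lambda>\<close> the series is \<open>\<Sum>k (a gchoose k)\<^sup>2\<close>, to be evaluated as
  \<open>\<Gamma>(2a + 1) / \<Gamma>(a + 1)\<^sup>2\<close>. This is Gauss' summation of \<open>F(-a, -a; c; 1)\<close> at \<open>c = 1\<close>.
  Following Gauss, let \<open>c = m + 1\<close> vary: a telescoping relation between the terms for \<open>c\<close> and
  \<open>c + 1\<close> gives \<open>S\<^sub>m = (m+1+a)\<^sup>2 / ((m+1) (m+1+2a)) \<cdot> S\<^sub>m\<^sub>+\<^sub>1\<close>. Moreover \<open>S\<^sub>m \<longlonglongrightarrow> 1\<close>, so \<open>S\<^sub>0\<close> is the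
  infinite product of these factors, which Euler's limit for \<open>\<Gamma>\<close> evaluates.
\<close>

section \<open>Growth of \<open>a gchoose k\<close> in \<open>k\<close>\<close>

text \<open>Up to the sign \<open>(-1)^k\<close>, the product
  \<open>(a gchoose k) * k powr (a + 1)\<close> converges by the asymptotic formula, so it is
  bounded.\<close>

lemma gbinomial_square_bound:
  fixes a :: real
  obtains K where "\<And>k. k > 0 \<Longrightarrow> (a gchoose k)\<^sup>2 \<le> K * real k powr (- (2 * a + 2))"
proof -
  have "Bseq (\<lambda>n. (a gchoose n) / ((-1)^n / exp ((a+1) * of_real (ln (real n)))))"
    using gbinomial_asymptotic[of a] by (intro convergent_imp_Bseq convergentI)
  then obtain K where K:
    "\<And>n. norm ((a gchoose n) / ((-1)^n / exp ((a+1) * of_real (ln (real n))))) \<le> K"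
    by (rule BseqE) blast
  have "(a gchoose k)\<^sup>2 \<le> K\<^sup>2 * real k powr (- (2 * a + 2))" if k: "k > 0" for k
  proof -
    have "\<bar>a gchoose k\<bar> * real k powr (a + 1) \<le> K"
      using K[of k] k by (simp add: abs_mult power_abs powr_def)
    then have "(\<bar>a gchoose k\<bar> * real k powr (a + 1))\<^sup>2 \<le> K\<^sup>2"
      by (intro power_mono) auto
    moreover have "(real k powr (a + 1))\<^sup>2 = real k powr (2 * a + 2)"
      by (simp add: power2_eq_square flip: powr_add)
    ultimately have "(a gchoose k)\<^sup>2 * real k powr (2 * a + 2) \<le> K\<^sup>2"
      by (simp add: power_mult_distrib)
    then show ?thesis
      using k by (subst powr_minus) (simp add: field_simps)
  qed
  then show thesis by (rule that)
qed

text \<open>The exponent satisfies \<open>2 * a + 2 > 1\<close> exactly when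
  \<open>a > -1/2\<close>.\<close>

lemma summable_gbinomial_square:
  fixes a :: real
  assumes "a > -1/2"
  shows "summable (\<lambda>k. (a gchoose k)\<^sup>2)"
proof -
  obtain K where K: "\<And>k. k > 0 \<Longrightarrow> (a gchoose k)\<^sup>2 \<le> K * real k powr (- (2 * a + 2))"
    using gbinomial_square_bound by blast
  have "summable (\<lambda>k. K * real k powr (- (2 * a + 2)))"
    using assms by (intro summable_mult) (simp add: summable_real_powr_iff)
  then show ?thesis
    by (rule summable_comparison_test'[where N = 1]) (use K in auto)
qed

text \<open>This makes the boundary term at infinity of the telescoping sum vanish: the factor
  \<open>k\<close> still leaves the negative exponent \<open>-(2 * a + 1)\<close>.\<close>

lemma tendsto_mult_gbinomial_square:
  fixes a :: real
  assumes "a > -1/2"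
  shows "(\<lambda>k. real k * (a gchoose k)\<^sup>2) \<longlonglongrightarrow> 0"
proof -
  obtain K where K: "\<And>k. k > 0 \<Longrightarrow> (a gchoose k)\<^sup>2 \<le> K * real k powr (- (2 * a + 2))"
    using gbinomial_square_bound by blast
  have "(\<lambda>k. K * real k powr (- (2 * a + 1))) \<longlonglongrightarrow> K * 0"
    using assms by (intro tendsto_mult tendsto_const tendsto_neg_powr filterlim_real_sequentially) auto
  then have lim: "(\<lambda>k. K * real k powr (- (2 * a + 1))) \<longlonglongrightarrow> 0"
    by simp
  have "norm (real k * (a gchoose k)\<^sup>2) \<le> K * real k powr (- (2 * a + 1))" if "k > 0" for k
  proof -
    have "real k * (a gchoose k)\<^sup>2 \<le> real k powr 1 * (K * real k powr (- (2 * a + 2)))"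
      using K[OF that] that by (simp add: mult_left_mono)
    also have "\<dots> = K * real k powr (1 + - (2 * a + 2))"
      by (simp only: powr_add mult_ac)
    also have "1 + - (2 * a + 2) = - (2 * a + 1)" by simp
    finally show ?thesis by simp
  qed
  then show ?thesis
    by (intro Lim_null_comparison[OF _ lim] eventually_mono[OF eventually_gt_at_top[of 0]])
qed

section \<open>Terms of the hypergeometric series and their contiguity relation\<close>

text \<open>The term of index \<open>k\<close> in F(-a, -a; m+1; 1): there
  \<open>pochhammer (-a) k\<close> is \<open>(-1)^k * fact k * (a gchoose k)\<close>, and
  \<open>pochhammer (m + 1) k\<close> is \<open>fact k\<close> times the binomial coefficient in the
  denominator.\<close>

definition gauss_term :: "real \<Rightarrow> nat \<Rightarrow> nat \<Rightarrow> real"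
  where "gauss_term a m k = (a gchoose k)\<^sup>2 / real ((m + k) choose k)"

lemma gauss_term_nonneg: "gauss_term a m k \<ge> 0"
  by (simp add: gauss_term_def)

lemma gauss_term_0_right [simp]: "gauss_term a m 0 = 1"
  by (simp add: gauss_term_def)

lemma gauss_term_0: "gauss_term a 0 k = (a gchoose k)\<^sup>2"
  by (simp add: gauss_term_def)

lemma Suc_times_binomial_add_same:
  "real (m + 1) * real ((Suc m + k) choose k) = (real m + 1 + real k) * real ((m + k) choose k)"
proof -
  have "Suc m * (Suc (m + k) choose Suc m) = Suc (m + k) * ((m + k) choose m)"
    by (simp only: Suc_times_binomial_eq mult.commute)
  moreover have "Suc (m + k) choose Suc m = (Suc m + k) choose k" "(m + k) choose m = (m + k) choose k"
    using binomial_symmetric[of k "Suc m + k"] binomial_symmetric[of k "m + k"]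
    by (simp_all del: binomial_Suc_Suc)
  ultimately have "real (Suc m * ((Suc m + k) choose k)) = real (Suc (m + k) * ((m + k) choose k))"
    by (simp only:)
  then show ?thesis by (simp only: of_nat_mult) (simp add: add.assoc)
qed

lemma gauss_term_Suc:
  "gauss_term a (Suc m) k = (real m + 1) / (real m + 1 + real k) * gauss_term a m k"
proof -
  define B where "B = real ((m + k) choose k)"
  define B' where "B' = real ((Suc m + k) choose k)"
  have pos: "B > 0" "real m + 1 > 0" "real m + 1 + real k > 0"
    by (simp_all add: B_def)
  have "(real m + 1) * B' = (real m + 1 + real k) * B"
    using Suc_times_binomial_add_same[of m k] by (simp add: B_def B'_def add.commute)
  then have "B' = (real m + 1 + real k) * B / (real m + 1)"
    using pos by (simp add: field_simps)
  then show ?thesis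
    using pos unfolding gauss_term_def B_def[symmetric] B'_def[symmetric] by simp
qed

text \<open>The factor \<open>Suc k\<close> stays on the left because this product is the shifted
  term of the telescoping difference.\<close>

lemma gauss_term_Suc_right:
  "real (Suc k) * gauss_term a m (Suc k) = (a - real k)\<^sup>2 / (real m + 1 + real k) * gauss_term a m k"
proof -
  define B where "B = real ((m + k) choose k)"
  define B' where "B' = real ((m + Suc k) choose Suc k)"
  define g where "g = (a gchoose Suc k)"
  have pos: "B > 0" "real (Suc k) > 0" "real m + 1 + real k > 0"
    by (simp_all add: B_def)
  have "Suc k * (Suc (m + k) choose Suc k) = Suc (m + k) * ((m + k) choose k)"
    by (simp only: Suc_times_binomial_eq mult.commute)
  then have "real (Suc k) * B' = real (Suc (m + k)) * B"
    unfolding B_def B'_def by (metis add_Suc_right of_nat_mult)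
  then have B': "B' = (real m + 1 + real k) * B / real (Suc k)"
    using pos by (simp add: field_simps)
  have "(a - real k) * (a gchoose k) = real (Suc k) * g"
    using gbinomial_mult_1[of a k] by (simp add: g_def algebra_simps)
  then have "(a - real k)\<^sup>2 * (a gchoose k)\<^sup>2 = (real (Suc k))\<^sup>2 * g\<^sup>2"
    by (metis power_mult_distrib)
  then have "(a - real k)\<^sup>2 / (real m + 1 + real k) * gauss_term a m k
      = (real (Suc k))\<^sup>2 * g\<^sup>2 / ((real m + 1 + real k) * B)"
    by (simp add: gauss_term_def flip: B_def)
  also have "\<dots> = real (Suc k) * gauss_term a m (Suc k)"
    using pos unfolding gauss_term_def B'_def[symmetric] g_def[symmetric] B'
    by (simp add: power2_eq_square)
  finally show ?thesis ..
qed

lemma gauss_term_le: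
  "k > 0 \<Longrightarrow> gauss_term a m k \<le> (a gchoose k)\<^sup>2 / (real m + 1)"
proof -
  assume "k > 0"
  then obtain j where k: "k = Suc j" by (cases k) auto
  \<comment> \<open>By Pascal's rule, each increment of \<open>m\<close> adds a positive binomial
    coefficient.\<close>
  have "m + 1 \<le> (m + k) choose k"
  proof (induction m)
    case (Suc m)
    have "(m + k) choose j \<ge> 1"
      using k by (simp add: Suc_le_eq)
    with Suc k show ?case by simp
  qed simp
  then have "real m + 1 \<le> real ((m + k) choose k)"
    by linarith
  then show ?thesis
    unfolding gauss_term_def by (intro divide_left_mono) auto
qed

lemma gauss_term_le': "gauss_term a m k \<le> (a gchoose k)\<^sup>2"
proof -
  have "1 \<le> real ((m + k) choose k)"
    by (simp add: Suc_le_eq)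
  then show ?thesis
    using divide_left_mono[of 1 "real ((m + k) choose k)" "(a gchoose k)\<^sup>2"]
    by (simp add: gauss_term_def)
qed

text \<open>Both neighbouring terms are rational multiples of \<open>gauss_term a m k\<close>. After
  clearing the denominator \<open>c + k\<close>, either side has the coefficient
  \<open>c * k + 2 * a * k - a^2\<close>.\<close>

lemma gauss_term_telescope:
  fixes a :: real
  assumes "c = real m + 1"
  shows "(c + 2 * a) * gauss_term a m k - (c + a)\<^sup>2 / c * gauss_term a (Suc m) k
    = real k * gauss_term a m k - real (Suc k) * gauss_term a m (Suc k)"
proof -
  have pos: "c > 0" "c + real k > 0" using assms by auto
  have "(c + 2 * a) - (c + a)\<^sup>2 / (c + real k) = real k - (a - real k)\<^sup>2 / (c + real k)"
    using pos by (simp add: field_simps power2_eq_square)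
  from arg_cong[OF this, of "\<lambda>x. x * gauss_term a m k"] show ?thesis
    using pos by (simp add: gauss_term_Suc gauss_term_Suc_right left_diff_distrib
        del: of_nat_Suc flip: assms)
qed

lemma summable_gauss_term:
  assumes "a > -1/2"
  shows "summable (gauss_term a m)"
  by (rule summable_comparison_test'[OF summable_gbinomial_square[OF assms], where N = 0])
     (simp add: gauss_term_nonneg gauss_term_le')

section \<open>Recurrence and limit of the sums in \<open>m\<close>\<close>

text \<open>Summing the telescoping relation over \<open>k\<close> gives 0: the boundary term is 0
  at \<open>k = 0\<close> and tends to 0 at infinity.\<close>

lemma suminf_gauss_term_Suc:
  assumes a: "a > -1/2"
  shows "suminf (gauss_term a m)
    = (real m + 1 + a)\<^sup>2 / ((real m + 1) * (real m + 1 + 2 * a)) * suminf (gauss_term a (Suc m))"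
proof -
  define c where "c = real m + 1"
  have pos: "c > 0" "c + 2 * a > 0" using a by (auto simp: c_def)
  have "(\<lambda>k. real k * gauss_term a m k) \<longlonglongrightarrow> 0"
    by (rule Lim_null_comparison[OF _ tendsto_mult_gbinomial_square[OF a]])
       (auto intro!: always_eventually mult_left_mono simp: abs_mult gauss_term_nonneg gauss_term_le')
  from telescope_sums'[OF this]
  have "(\<lambda>k. (c + 2 * a) * gauss_term a m k - (c + a)\<^sup>2 / c * gauss_term a (Suc m) k) sums 0"
    by (simp only: gauss_term_telescope[OF c_def]) simp
  moreover have "(\<lambda>k. (c + 2 * a) * gauss_term a m k - (c + a)\<^sup>2 / c * gauss_term a (Suc m) k) sums
      ((c + 2 * a) * suminf (gauss_term a m) - (c + a)\<^sup>2 / c * suminf (gauss_term a (Suc m)))"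
    by (intro sums_diff sums_mult summable_sums summable_gauss_term a)
  ultimately have "(c + 2 * a) * suminf (gauss_term a m) = (c + a)\<^sup>2 / c * suminf (gauss_term a (Suc m))"
    using sums_unique2 by fastforce
  then have "suminf (gauss_term a m)
      = (c + a)\<^sup>2 / (c * (c + 2 * a)) * suminf (gauss_term a (Suc m))"
    using pos by (simp add: nonzero_eq_divide_eq mult_ac)
  then show ?thesis
    by (simp only: c_def)
qed

text \<open>The term at \<open>k = 0\<close> is 1 for every \<open>m\<close>, while the remaining
  sum lies between 0 and \<open>S / (m + 1)\<close>.\<close>

lemma suminf_gauss_term_tendsto:
  assumes a: "a > -1/2"
  shows "(\<lambda>m. suminf (gauss_term a m)) \<longlonglongrightarrow> 1"
proof -
  define S where "S = (\<Sum>k. (a gchoose Suc k)\<^sup>2)"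
  have sS: "summable (\<lambda>k. (a gchoose Suc k)\<^sup>2)"
    using summable_gbinomial_square[OF a] by (subst summable_Suc_iff)
  have split: "suminf (gauss_term a m) = 1 + (\<Sum>k. gauss_term a m (Suc k))" for m
    using suminf_split_head[OF summable_gauss_term[OF a, of m]] by simp
  have sm: "summable (\<lambda>k. gauss_term a m (Suc k))" for m
    using summable_gauss_term[OF a] by (subst summable_Suc_iff)
  have "(\<Sum>k. gauss_term a m (Suc k)) \<le> S / (real m + 1)" for m
  proof -
    have "(\<Sum>k. gauss_term a m (Suc k)) \<le> (\<Sum>k. (a gchoose Suc k)\<^sup>2 / (real m + 1))"
      by (intro suminf_le gauss_term_le sm summable_divide sS) auto
    then show ?thesis
      by (simp add: S_def suminf_divide[OF sS])
  qed
  moreover have "(\<Sum>k. gauss_term a m (Suc k)) \<ge> 0" for m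
    by (intro suminf_nonneg sm gauss_term_nonneg)
  moreover have "(\<lambda>m. 1 + S / (real m + 1)) \<longlonglongrightarrow> 1 + 0"
    using LIMSEQ_Suc[OF lim_const_over_n[of S]]
    by (intro tendsto_add tendsto_const) (simp add: add.commute)
  ultimately show ?thesis
    by (rule_tac real_tendsto_sandwich[where f = "\<lambda>_. 1" and h = "\<lambda>m. 1 + S / (real m + 1)"])
       (simp_all add: split)
qed

section \<open>Evaluation of the infinite product\<close>

lemma suminf_gauss_term_0:
  assumes a: "a > -1/2"
  shows "suminf (gauss_term a 0)
    = (pochhammer (a + 1) N)\<^sup>2 / (fact N * pochhammer (2 * a + 1) N) * suminf (gauss_term a N)"
proof (induction N)
  case (Suc N)
  show ?case
    by (subst Suc, subst suminf_gauss_term_Suc[OF a])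
       (simp add: pochhammer_Suc power_mult_distrib add_ac mult_ac)
qed simp

text \<open>The quotient is rewritten in Euler's approximants \<open>Gamma_series'\<close>, which
  carry \<open>fact (N - 1)\<close> in the numerator and the Pochhammer symbol in the
  denominator.\<close>

lemma pochhammer_quotient_tendsto:
  fixes a :: real
  assumes a: "a > -1/2"
  shows "(\<lambda>N. (pochhammer (a + 1) N)\<^sup>2 / (fact N * pochhammer (2 * a + 1) N))
    \<longlonglongrightarrow> Gamma (2 * a + 1) / (Gamma (a + 1))\<^sup>2"
proof (rule Lim_transform_eventually)
  have "Gamma (a + 1) > 0"
    using a by (intro Gamma_real_pos) simp
  then show "(\<lambda>N. Gamma_series' (2 * a + 1) N / (Gamma_series' (a + 1) N)\<^sup>2)
      \<longlonglongrightarrow> Gamma (2 * a + 1) / (Gamma (a + 1))\<^sup>2"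
    by (intro tendsto_divide tendsto_power Gamma_series'_LIMSEQ) auto
  show "\<forall>\<^sub>F N in sequentially. Gamma_series' (2 * a + 1) N / (Gamma_series' (a + 1) N)\<^sup>2
      = (pochhammer (a + 1) N)\<^sup>2 / (fact N * pochhammer (2 * a + 1) N)"
    using eventually_gt_at_top[of 0]
  proof eventually_elim
    case (elim N)
    define p where "p = pochhammer (a + 1) N"
    define q where "q = pochhammer (2 * a + 1) N"
    have pos: "p > 0" "q > 0"
      using a by (auto simp: p_def q_def intro!: pochhammer_pos)
    define E where "E = exp ((2 * a + 1) * ln (real N))"
    \<comment> \<open>The powers of \<open>N\<close> have exponents \<open>2 * a + 2\<close> and
      \<open>2 * a + 1\<close>; the surplus factor \<open>N\<close> completes
      \<open>fact (N - 1)\<close> to \<open>fact N\<close>.\<close>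
    have E: "(exp ((a + 1) * ln (real N)))\<^sup>2 = E * real N"
    proof -
      have "(exp ((a + 1) * ln (real N)))\<^sup>2 = exp ((2 * a + 1) * ln (real N) + ln (real N))"
        by (simp add: power2_eq_square algebra_simps flip: exp_add)
      then show ?thesis
        using elim by (simp add: E_def exp_add)
    qed
    have f: "(fact N :: real) = real N * fact (N - 1)"
      using elim by (rule fact_reduce)
    have "E > 0" by (simp add: E_def)
    then show ?case
      using elim pos
      by (simp add: Gamma_series'_def power_divide power_mult_distrib E f flip: p_def q_def E_def)
         (simp add: power2_eq_square)
  qed
qed

theorem gbinomial_square_sums:
  fixes a :: real
  assumes a: "a > -1/2"
  shows "(\<lambda>k. (a gchoose k)\<^sup>2) sums (Gamma (2 * a + 1) / (Gamma (a + 1))\<^sup>2)"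
proof -
  \<comment> \<open>The product of the two convergent sequences is constant in \<open>N\<close>, so
    its value equals the product of their limits.\<close>
  have "(\<lambda>N. suminf (gauss_term a 0)) \<longlonglongrightarrow> Gamma (2 * a + 1) / (Gamma (a + 1))\<^sup>2 * 1"
    using tendsto_mult[OF pochhammer_quotient_tendsto[OF a] suminf_gauss_term_tendsto[OF a]]
    by (simp only: suminf_gauss_term_0[OF a, symmetric])
  then have "suminf (gauss_term a 0) = Gamma (2 * a + 1) / (Gamma (a + 1))\<^sup>2"
    by (simp add: LIMSEQ_const_iff)
  then show ?thesis
    using summable_sums[OF summable_gauss_term[OF a, of 0]] by (simp add: gauss_term_0 [abs_def])
qed

section \<open>Reduction of degenerate to ordinary binomial coefficients\<close>

text \<open>Each of the \<open>k\<close> factors yields one \<open>l\<close>; squared, the resulting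
  power cancels the weight \<open>l powi (- 2 * int k)\<close> of the series.\<close>

lemma degenerate_binomial_eq_gbinomial:
  assumes "l \<noteq> 0"
  shows "degenerate_binomial l x k = l ^ k * ((x / l) gchoose k)"
proof -
  have "(\<Prod>i<k. x - real i * l) = (\<Prod>i<k. l * (x / l - real i))"
    using assms by (intro prod.cong) (auto simp: field_simps)
  also have "\<dots> = l ^ k * (\<Prod>i<k. x / l - real i)"
    by (simp add: prod.distrib)
  finally show ?thesis
    by (simp add: degenerate_binomial_def degenerate_falling_factorial_def gbinomial_prod_rev
        lessThan_atLeast0)
qed

theorem theorem2p4:
  fixes l :: real and n :: nat
  assumes "l > 0" and "n > 0"
  shows "(\<lambda>k. l powi (- 2 * int k) * (degenerate_binomial l (real n) k)\<^sup>2) sums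
           (2 * l / real n * (Gamma (2 * real n / l) / (Gamma (real n / l))\<^sup>2))"
proof -
  define a where "a = real n / l"
  have a: "a > 0" using assms by (simp add: a_def)
  have "l powi (- 2 * int k) * (degenerate_binomial l (real n) k)\<^sup>2 = (a gchoose k)\<^sup>2" for k
  proof -
    have "l powi (- 2 * int k) = inverse (l ^ (2 * k))"
      using power_int_minus[of l "int (2 * k)"] by (simp only: power_int_of_nat) simp
    then show ?thesis
      using assms by (simp add: degenerate_binomial_eq_gbinomial power_mult_distrib a_def
          flip: power_mult) (simp add: mult.commute)
  qed
  moreover have "Gamma (2 * a + 1) / (Gamma (a + 1))\<^sup>2
      = 2 * l / real n * (Gamma (2 * real n / l) / (Gamma (real n / l))\<^sup>2)"
  proof -
    \<comment> \<open>The functional equation contributes \<open>2 * a / a^2 = 2 / a\<close>, which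
      is the prefactor \<open>2 * l / n\<close>.\<close>
    have "Gamma (2 * a + 1) = 2 * a * Gamma (2 * a)" "Gamma (a + 1) = a * Gamma a"
      using a by (intro Gamma_plus1; force dest: nonpos_Ints_nonpos)+
    moreover have "2 * real n / l = 2 * a" "2 * l / real n = 2 / a"
      using assms by (simp_all add: a_def)
    ultimately show ?thesis
      using a by (simp add: power2_eq_square flip: a_def)
  qed
  ultimately show ?thesis
    using gbinomial_square_sums[of a] a by simp
qed

end
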